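(* On $\mathbb{R}^{2n}$ with coordinates $z^i=(q^a,p_b)$ and canonical Poisson bracket $\{\cdot,\cdot\}_P$, let $H(z)$ be a function and let $\Phi^\alpha(z)$, $\alpha=1,\dots,2p<2n$, be functionally independent functions such that $$\det\{\Phi^\alpha,\Phi^\beta\}_P\big|_{\Phi^\alpha=0}\neq0,\qquad \{\Phi^\alpha,H\}_P\big|_{\Phi^\alpha=0}=0 .$$ Then the system $$\dot z^i=\{z^i,H\}_P,\qquad \Phi^\alpha(z)=0$$ is self-consistent, and it is equivalent to (i.e. has the same solutions as) the system $$\dot z^i=\{z^i,H\}_D,\qquad \Phi^\alpha(z)=0,$$ where $\{A,B\}_D=\{A,B\}_P-\{A,\Phi^\alpha\}_P\,\tilde\triangle_{\alpha\beta}\,\{\Phi^\beta,B\}_P$ is the Dirac bracket and $\tilde\triangle_{\alpha\beta}$ is the inverse matrix of $\triangle^{\alpha\beta}=\{\Phi^\alpha,\Phi^\beta\}_P$.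
   Context: All objects are smooth, and all statements are local (solutions are defined for $\tau$ in a neighbourhood of the initial time; the Dirac bracket is considered in a neighbourhood of $\{\Phi^\alpha=0\}$ where $\triangle^{\alpha\beta}$ is invertible). Repeated indices are summed and $\dot z^i=dz^i/d\tau$. The canonical Poisson bracket is $\{A,B\}_P=\frac{\partial A}{\partial q^a}\frac{\partial B}{\partial p_a}-\frac{\partial B}{\partial q^a}\frac{\partial A}{\partial p_a}$. Functions $\Phi^\alpha$, $\alpha=1,\dots,2p$, are functionally independent if $\operatorname{rank}(\partial_i\Phi^\alpha)=2p$. A system consisting of differential equations $\dot z^i=V^i(z)$ and algebraic equations $\Phi^\alpha(z)=0$ is called self-consistent if through any point of the surface $\{\Phi^\alpha=0\}$ passes a solution $z^i(\tau)$ of the system (so $\Phi^\alpha(z(\tau))=0$ for all $\tau$). *)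

theory Defs
  imports "HOL-Analysis.Analysis"
begin

text \<open>Phase space is \<open>real ^ ('n + 'n)\<close>: for a phase point \<open>z\<close>, the
  position coordinate \<open>q\<^sup>a\<close> is \<open>z $ Inl a\<close> and the momentum \<open>p\<^sub>a\<close> is \<open>z $ Inr a\<close>.\<close>

definition partial :: "'i::finite \<Rightarrow> (real ^ 'i \<Rightarrow> real) \<Rightarrow> real ^ 'i \<Rightarrow> real" where
  "partial i f z = frechet_derivative f (at z) (axis i 1)"

primrec times_differentiable :: "nat \<Rightarrow> (real ^ 'i::finite \<Rightarrow> real) \<Rightarrow> bool" where
  "times_differentiable 0 f \<longleftrightarrow> continuous_on UNIV f"
| "times_differentiable (Suc k) f \<longleftrightarrow>
     (\<forall>z. f differentiable (at z)) \<and> (\<forall>i. times_differentiable k (partial i f))"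

definition smooth :: "(real ^ 'i::finite \<Rightarrow> real) \<Rightarrow> bool" where
  "smooth f \<longleftrightarrow> (\<forall>k. times_differentiable k f)"

definition poisson ::
  "(real ^ ('n + 'n) \<Rightarrow> real) \<Rightarrow> (real ^ ('n + 'n) \<Rightarrow> real) \<Rightarrow> real ^ ('n::finite + 'n) \<Rightarrow> real"
  where
  "poisson A B z = (\<Sum>a\<in>UNIV.
     partial (Inl a) A z * partial (Inr a) B z - partial (Inl a) B z * partial (Inr a) A z)"

definition constraint_surface :: "('k \<Rightarrow> 'z \<Rightarrow> real) \<Rightarrow> 'z set" where
  "constraint_surface \<Phi> = {z. \<forall>\<alpha>. \<Phi> \<alpha> z = 0}"

definition functionally_independent_on ::
  "(real ^ 'i::finite) set \<Rightarrow> ('k::finite \<Rightarrow> real ^ 'i \<Rightarrow> real) \<Rightarrow> bool" where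
  "functionally_independent_on S \<Phi> \<longleftrightarrow>
     (\<forall>z\<in>S. rank ((\<chi> \<alpha> i. partial i (\<Phi> \<alpha>) z) :: real ^ 'i ^ 'k) = CARD('k))"

definition bracket_matrix ::
  "('k::finite \<Rightarrow> real ^ ('n + 'n) \<Rightarrow> real) \<Rightarrow> real ^ ('n::finite + 'n) \<Rightarrow> real ^ 'k ^ 'k" where
  "bracket_matrix \<Phi> z = (\<chi> \<alpha> \<beta>. poisson (\<Phi> \<alpha>) (\<Phi> \<beta>) z)"

text \<open>Only meaningful where \<open>bracket_matrix \<Phi> z\<close> is invertible; elsewhere \<open>matrix_inv\<close>
  is unspecified.\<close>

definition dirac ::
  "('k::finite \<Rightarrow> real ^ ('n + 'n) \<Rightarrow> real) \<Rightarrow>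
   (real ^ ('n + 'n) \<Rightarrow> real) \<Rightarrow> (real ^ ('n + 'n) \<Rightarrow> real) \<Rightarrow> real ^ ('n::finite + 'n) \<Rightarrow> real"
  where
  "dirac \<Phi> A B z = poisson A B z -
     (\<Sum>\<alpha>\<in>UNIV. \<Sum>\<beta>\<in>UNIV.
        poisson A (\<Phi> \<alpha>) z * matrix_inv (bracket_matrix \<Phi> z) $ \<alpha> $ \<beta> * poisson (\<Phi> \<beta>) B z)"

definition bracket_field ::
  "((real ^ 'i \<Rightarrow> real) \<Rightarrow> (real ^ 'i \<Rightarrow> real) \<Rightarrow> real ^ 'i \<Rightarrow> real) \<Rightarrow>
   (real ^ 'i \<Rightarrow> real) \<Rightarrow> real ^ 'i::finite \<Rightarrow> real ^ 'i" where
  "bracket_field br H z = (\<chi> i. br (\<lambda>w. w $ i) H z)"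

definition solution_on ::
  "('z::real_normed_vector \<Rightarrow> 'z) \<Rightarrow> ('k \<Rightarrow> 'z \<Rightarrow> real) \<Rightarrow> real set \<Rightarrow> (real \<Rightarrow> 'z) \<Rightarrow> bool" where
  "solution_on V \<Phi> T z \<longleftrightarrow>
     (\<forall>\<tau>\<in>T. (z has_vector_derivative V (z \<tau>)) (at \<tau>) \<and> (\<forall>\<alpha>. \<Phi> \<alpha> (z \<tau>) = 0))"

definition self_consistent ::
  "('z::real_normed_vector \<Rightarrow> 'z) \<Rightarrow> ('k \<Rightarrow> 'z \<Rightarrow> real) \<Rightarrow> bool" where
  "self_consistent V \<Phi> \<longleftrightarrow>
     (\<forall>z\<^sub>0\<in>constraint_surface \<Phi>. \<forall>\<tau>\<^sub>0. \<exists>\<epsilon>>0. \<exists>z.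
        z \<tau>\<^sub>0 = z\<^sub>0 \<and> solution_on V \<Phi> {\<tau>\<^sub>0 - \<epsilon><..<\<tau>\<^sub>0 + \<epsilon>} z)"

definition same_solutions ::
  "('z::real_normed_vector \<Rightarrow> 'z) \<Rightarrow> ('k \<Rightarrow> 'z \<Rightarrow> real) \<Rightarrow>
   ('z \<Rightarrow> 'z) \<Rightarrow> ('l \<Rightarrow> 'z \<Rightarrow> real) \<Rightarrow> bool" where
  "same_solutions V \<Phi> W \<Psi> \<longleftrightarrow>
     (\<forall>T z. open T \<and> is_interval T \<longrightarrow> solution_on V \<Phi> T z = solution_on W \<Psi> T z)"

end

theory Submission
  imports Defs
begin

text \<open>The flow of the Dirac field is tangent to every level set of the constraints, since
  \<open>{\<Phi>\<^sup>\<alpha>, H}\<^sub>D = 0\<close> identically wherever \<open>\<triangle>\<close> is invertible, not merely on the surface. Its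
  integral curves exist by Picard's theorem, so those starting on the surface stay there. On the
  surface the Dirac field coincides with the canonical one because \<open>{\<Phi>\<^sup>\<alpha>, H}\<^sub>P = 0\<close> there, so
  these curves solve the canonical system as well.\<close>

section \<open>Functions that are Lipschitz near a point\<close>

text \<open>This is the regularity that Picard iteration asks for, and it survives sums, products
  and inverses of nonvanishing functions. Quotients of determinants can thus be handled without
  differentiating them. The ball is closed because \<open>picard_lindeloef_local\<close> projects
  onto it.\<close>

definition lipschitz_near :: "'a::metric_space \<Rightarrow> ('a \<Rightarrow> 'b::metric_space) \<Rightarrow> bool" where
  "lipschitz_near x f \<longleftrightarrow> (\<exists>r>0. \<exists>L. L-lipschitz_on (cball x r) f)"

lemma lipschitz_near_shrink:
  assumes "lipschitz_near x f" "lipschitz_near x g"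
  obtains r L M where "r > 0" "L-lipschitz_on (cball x r) f" "M-lipschitz_on (cball x r) g"
proof -
  obtain r L s M where *: "r > 0" "L-lipschitz_on (cball x r) f" "s > 0" "M-lipschitz_on (cball x s) g"
    using assms unfolding lipschitz_near_def by blast
  have "L-lipschitz_on (cball x (min r s)) f" "M-lipschitz_on (cball x (min r s)) g"
    by (auto intro: lipschitz_on_subset[OF *(2)] lipschitz_on_subset[OF *(4)])
  with * show thesis
    by (intro that[of "min r s"]) auto
qed

lemma lipschitz_near_isCont:
  assumes "lipschitz_near x f"
  shows "isCont f x"
proof -
  obtain r L where "r > 0" and L: "L-lipschitz_on (cball x r) f"
    using assms unfolding lipschitz_near_def by blast
  then have "x \<in> interior (cball x r)"
    unfolding mem_interior using ball_subset_cball by blast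
  then show ?thesis
    using lipschitz_on_continuous_on[OF L] continuous_on_interior by blast
qed

lemma lipschitz_near_const: "lipschitz_near x (\<lambda>_. c)"
  unfolding lipschitz_near_def by (intro exI[of _ 1] conjI exI[of _ 0]) (auto intro: lipschitz_on_constant)

lemma lipschitz_near_add:
  fixes f g :: "'a::metric_space \<Rightarrow> 'b::real_normed_vector"
  assumes "lipschitz_near x f" "lipschitz_near x g"
  shows "lipschitz_near x (\<lambda>y. f y + g y)"
  by (rule lipschitz_near_shrink[OF assms]) (auto simp: lipschitz_near_def intro: lipschitz_on_add)

lemma lipschitz_near_minus:
  fixes f :: "'a::metric_space \<Rightarrow> 'b::real_normed_vector"
  assumes "lipschitz_near x f"
  shows "lipschitz_near x (\<lambda>y. - f y)"
  using assms by (auto simp: lipschitz_near_def)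

lemma lipschitz_near_diff:
  fixes f g :: "'a::metric_space \<Rightarrow> 'b::real_normed_vector"
  assumes "lipschitz_near x f" "lipschitz_near x g"
  shows "lipschitz_near x (\<lambda>y. f y - g y)"
  using lipschitz_near_add[OF assms(1) lipschitz_near_minus[OF assms(2)]] by simp

lemma lipschitz_near_sum:
  fixes f :: "'i \<Rightarrow> 'a::metric_space \<Rightarrow> 'b::real_normed_vector"
  assumes "\<And>i. i \<in> I \<Longrightarrow> lipschitz_near x (f i)"
  shows "lipschitz_near x (\<lambda>y. \<Sum>i\<in>I. f i y)"
  using assms
  by (induction I rule: infinite_finite_induct) (auto intro: lipschitz_near_const lipschitz_near_add)

text \<open>On the ball each factor is bounded by its value at the centre plus its Lipschitz
  constant times the radius. Splitting the increment as in the product rule then gives the constant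
  \<open>C\<close>.\<close>

lemma lipschitz_near_mult:
  fixes f g :: "'a::metric_space \<Rightarrow> real"
  assumes "lipschitz_near x f" "lipschitz_near x g"
  shows "lipschitz_near x (\<lambda>y. f y * g y)"
proof (rule lipschitz_near_shrink[OF assms])
  fix r L M
  assume r: "r > 0" and L: "L-lipschitz_on (cball x r) f" and M: "M-lipschitz_on (cball x r) g"
  have nn: "L \<ge> 0" "M \<ge> 0"
    using L M by (auto dest: lipschitz_on_nonneg)
  have bound: "\<bar>h y\<bar> \<le> \<bar>h x\<bar> + K * r"
    if K: "K-lipschitz_on (cball x r) h" and y: "y \<in> cball x r" for K y and h :: "'a \<Rightarrow> real"
  proof -
    have "\<bar>h x - h y\<bar> \<le> K * dist x y"
      using lipschitz_onD[OF K _ y, of x] r by (auto simp: dist_real_def)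
    also have "\<dots> \<le> K * r"
      using y lipschitz_on_nonneg[OF K] by (intro mult_left_mono) auto
    finally show ?thesis by linarith
  qed
  define C where "C = (\<bar>f x\<bar> + L * r) * M + (\<bar>g x\<bar> + M * r) * L"
  have "C-lipschitz_on (cball x r) (\<lambda>y. f y * g y)"
  proof (rule lipschitz_onI)
    fix u v
    assume u: "u \<in> cball x r" and v: "v \<in> cball x r"
    have "f u * g u - f v * g v = f u * (g u - g v) + g v * (f u - f v)"
      by (simp add: algebra_simps)
    then have "\<bar>f u * g u - f v * g v\<bar> \<le> \<bar>f u\<bar> * \<bar>g u - g v\<bar> + \<bar>g v\<bar> * \<bar>f u - f v\<bar>"
      by (metis abs_mult abs_triangle_ineq)
    also have "\<dots> \<le> (\<bar>f x\<bar> + L * r) * (M * dist u v) + (\<bar>g x\<bar> + M * r) * (L * dist u v)"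
      using bound[OF L u] bound[OF M v] lipschitz_onD[OF L u v] lipschitz_onD[OF M u v] nn r
      by (intro add_mono mult_mono) (auto simp: dist_real_def)
    finally show "dist (f u * g u) (f v * g v) \<le> C * dist u v"
      by (simp add: dist_real_def C_def algebra_simps)
  qed (use nn r in \<open>simp add: C_def\<close>)
  then show ?thesis
    using r by (auto simp: lipschitz_near_def)
qed

lemma lipschitz_near_prod:
  fixes f :: "'i \<Rightarrow> 'a::metric_space \<Rightarrow> real"
  assumes "\<And>i. i \<in> I \<Longrightarrow> lipschitz_near x (f i)"
  shows "lipschitz_near x (\<lambda>y. \<Prod>i\<in>I. f i y)"
  using assms
  by (induction I rule: infinite_finite_induct) (auto intro: lipschitz_near_const lipschitz_near_mult)

text \<open>Continuity at \<open>x\<close> allows shrinking the ball until \<open>f\<close> keeps at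
  least half of its absolute value at \<open>x\<close>. The denominator of a difference of inverses
  is then at least \<open>(f x)\<^sup>2 / 4\<close>, whence the 4 in \<open>C\<close>.\<close>

lemma lipschitz_near_inverse:
  fixes f :: "'a::metric_space \<Rightarrow> real"
  assumes "lipschitz_near x f" "f x \<noteq> 0"
  shows "lipschitz_near x (\<lambda>y. inverse (f y))"
proof -
  obtain r L where r: "r > 0" and L: "L-lipschitz_on (cball x r) f"
    using assms unfolding lipschitz_near_def by blast
  obtain d where d: "d > 0" "\<And>y. dist y x < d \<Longrightarrow> dist (f y) (f x) < \<bar>f x\<bar> / 2"
    using lipschitz_near_isCont[OF assms(1)] assms(2)
    unfolding continuous_at_eps_delta by (metis half_gt_zero zero_less_abs_iff)
  define s where "s = min r (d / 2)"
  have s: "s > 0" and sub: "cball x s \<subseteq> cball x r"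
    using r d by (auto simp: s_def)
  have low: "\<bar>f y\<bar> \<ge> \<bar>f x\<bar> / 2" if "y \<in> cball x s" for y
  proof -
    have "dist y x < d"
      using that d by (simp add: s_def dist_commute)
    from d(2)[OF this] show ?thesis
      unfolding dist_real_def by linarith
  qed
  define C where "C = L * (4 / (f x)\<^sup>2)"
  have "C-lipschitz_on (cball x s) (\<lambda>y. inverse (f y))"
  proof (rule lipschitz_onI)
    fix u v
    assume u: "u \<in> cball x s" and v: "v \<in> cball x s"
    have nz: "f u \<noteq> 0" "f v \<noteq> 0"
      using low[OF u] low[OF v] assms(2) by auto
    have "(f x)\<^sup>2 / 4 = (\<bar>f x\<bar> / 2) * (\<bar>f x\<bar> / 2)"
      by (simp add: power2_eq_square)
    also have "\<dots> \<le> \<bar>f u\<bar> * \<bar>f v\<bar>"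
      using low[OF u] low[OF v] by (intro mult_mono) auto
    finally have le: "(f x)\<^sup>2 / 4 \<le> \<bar>f u\<bar> * \<bar>f v\<bar>" .
    have "inverse (f u) - inverse (f v) = (f v - f u) / (f u * f v)"
      using nz by (simp add: field_simps)
    then have "\<bar>inverse (f u) - inverse (f v)\<bar> = \<bar>f u - f v\<bar> / (\<bar>f u\<bar> * \<bar>f v\<bar>)"
      by (simp add: abs_mult abs_minus_commute)
    also have "\<dots> \<le> (L * dist u v) / ((f x)\<^sup>2 / 4)"
      using le lipschitz_onD[OF L subsetD[OF sub u] subsetD[OF sub v]] assms(2)
        lipschitz_on_nonneg[OF L]
      by (intro frac_le) (auto simp: dist_real_def)
    finally show "dist (inverse (f u)) (inverse (f v)) \<le> C * dist u v"
      by (simp add: C_def dist_real_def field_simps)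
  qed (use lipschitz_on_nonneg[OF L] in \<open>simp add: C_def\<close>)
  then show ?thesis
    using s by (auto simp: lipschitz_near_def)
qed

lemma lipschitz_near_det:
  fixes A :: "'a::metric_space \<Rightarrow> real ^ 'k ^ 'k"
  assumes "\<And>i j. lipschitz_near x (\<lambda>y. A y $ i $ j)"
  shows "lipschitz_near x (\<lambda>y. det (A y))"
  unfolding det_def
  by (intro lipschitz_near_sum lipschitz_near_mult lipschitz_near_const lipschitz_near_prod assms)

text \<open>The map is the sum of its coordinates times the standard basis vectors. These have norm
  1, so each summand keeps the constant of its coordinate.\<close>

lemma lipschitz_near_vec:
  fixes f :: "'a::metric_space \<Rightarrow> real ^ 'i"
  assumes "\<And>i. lipschitz_near x (\<lambda>y. f y $ i)"
  shows "lipschitz_near x f"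
proof -
  have "lipschitz_near x (\<lambda>y. f y $ i *\<^sub>R (axis i 1 :: real ^ 'i))" for i
  proof -
    obtain r L where r: "r > 0" and L: "L-lipschitz_on (cball x r) (\<lambda>y. f y $ i)"
      using assms[of i] unfolding lipschitz_near_def by blast
    have "L-lipschitz_on (cball x r) (\<lambda>y. f y $ i *\<^sub>R (axis i 1 :: real ^ 'i))"
      using L by (auto simp: lipschitz_on_def dist_norm simp flip: scaleR_left_diff_distrib)
    with r show ?thesis
      by (auto simp: lipschitz_near_def)
  qed
  then have "lipschitz_near x (\<lambda>y. \<Sum>i\<in>UNIV. f y $ i *\<^sub>R (axis i 1 :: real ^ 'i))"
    by (rule lipschitz_near_sum)
  also have "(\<lambda>y. \<Sum>i\<in>UNIV. f y $ i *\<^sub>R (axis i 1 :: real ^ 'i)) = f"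
    by (simp add: basis_expansion flip: scalar_mult_eq_scaleR)
  finally show ?thesis .
qed

section \<open>Differentials and smooth functions\<close>

lemma frechet_derivative_eq_sum_partial:
  assumes "f differentiable (at z)"
  shows "frechet_derivative f (at z) h = (\<Sum>i\<in>UNIV. partial i f z * h $ i)"
proof -
  interpret linear "frechet_derivative f (at z)"
    by (rule linear_frechet_derivative[OF assms])
  have "frechet_derivative f (at z) h = frechet_derivative f (at z) (\<Sum>i\<in>UNIV. h $ i *\<^sub>R axis i 1)"
    using basis_expansion[of h] by (simp add: scalar_mult_eq_scaleR)
  also have "\<dots> = (\<Sum>i\<in>UNIV. partial i f z * h $ i)"
    by (simp add: sum scale partial_def mult.commute)
  finally show ?thesis .
qed

text \<open>The partial derivatives are bounded on the compact unit ball around \<open>x\<close>.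
  The sum of the bounds dominates the operator norm of the differential, and the mean value
  inequality applies on the convex ball.\<close>

lemma lipschitz_near_of_C1:
  fixes f :: "real ^ 'i \<Rightarrow> real"
  assumes diff: "\<And>z. f differentiable (at z)" and cont: "\<And>i. continuous_on UNIV (partial i f)"
  shows "lipschitz_near x f"
proof -
  have "\<exists>B. \<forall>y\<in>cball x 1. \<bar>partial i f y\<bar> \<le> B" for i
    using compact_imp_bounded[OF compact_continuous_image[OF continuous_on_subset[OF cont[of i] subset_UNIV] compact_cball[of x 1]]]
    unfolding bounded_iff by auto
  then obtain B where B: "\<And>i y. y \<in> cball x 1 \<Longrightarrow> \<bar>partial i f y\<bar> \<le> B i"
    by metis
  define C where "C = (\<Sum>i\<in>UNIV. B i)"
  have B0: "B i \<ge> 0" for i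
    using B[of x i] by simp
  have "C-lipschitz_on (cball x 1) f"
  proof (rule bounded_derivative_imp_lipschitz)
    show "(f has_derivative frechet_derivative f (at y)) (at y within cball x 1)" for y
      using diff frechet_derivative_works has_derivative_at_withinI by blast
    show "onorm (frechet_derivative f (at y)) \<le> C" if y: "y \<in> cball x 1" for y
    proof (rule onorm_le)
      fix h :: "real ^ 'i"
      have "norm (\<Sum>i\<in>UNIV. partial i f y * h $ i) \<le> (\<Sum>i\<in>UNIV. B i * norm h)"
      proof (rule order_trans[OF norm_sum sum_mono])
        show "norm (partial i f y * h $ i) \<le> B i * norm h" for i
          unfolding norm_mult using B[OF y] B0 component_le_norm_cart[of h i]
          by (intro mult_mono) auto
      qed
      then show "norm (frechet_derivative f (at y) h) \<le> C * norm h"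
        by (simp add: frechet_derivative_eq_sum_partial[OF diff] C_def sum_distrib_right)
    qed
  qed (auto simp: C_def intro: sum_nonneg B0)
  then show ?thesis
    unfolding lipschitz_near_def by (intro exI[of _ 1]) auto
qed

lemma smooth_differentiable: "smooth f \<Longrightarrow> f differentiable (at z)"
  unfolding smooth_def by (metis times_differentiable.simps(2))

lemma smooth_partial: "smooth f \<Longrightarrow> smooth (partial i f)"
  unfolding smooth_def by (metis times_differentiable.simps(2))

lemma smooth_continuous: "smooth f \<Longrightarrow> continuous_on UNIV f"
  unfolding smooth_def by (metis times_differentiable.simps(1))

lemma lipschitz_near_smooth: "smooth f \<Longrightarrow> lipschitz_near x f"
  by (intro lipschitz_near_of_C1 smooth_differentiable smooth_continuous smooth_partial)

section \<open>Poisson brackets and Hamiltonian vector fields\<close>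

lemma lipschitz_near_poisson:
  assumes "smooth A" "smooth B"
  shows "lipschitz_near x (poisson A B)"
  unfolding poisson_def[abs_def]
  by (intro lipschitz_near_sum lipschitz_near_diff lipschitz_near_mult lipschitz_near_smooth
      smooth_partial assms)

lemma partial_component: "partial j (\<lambda>w. w $ i) z = (if j = i then 1 else 0)"
proof -
  have "((\<lambda>w::real ^ 'a. w $ i) has_derivative (\<lambda>w. w $ i)) (at z)"
    by (intro bounded_linear_imp_has_derivative bounded_linear_vec_nth)
  then show ?thesis
    unfolding partial_def by (simp add: frechet_derivative_at[symmetric] axis_def)
qed

text \<open>These are the right-hand sides of Hamilton's equations with Hamiltonian
  \<open>B\<close>.\<close>

lemma bracket_field_poisson:
  "bracket_field poisson B z $ Inl a = partial (Inr a) B z"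
  "bracket_field poisson B z $ Inr a = - partial (Inl a) B z"
  by (simp_all add: bracket_field_def poisson_def partial_component mult_delta_left mult_delta_right
      sum_negf)

lemma lipschitz_near_bracket_field_poisson:
  assumes "smooth B"
  shows "lipschitz_near x (\<lambda>z. bracket_field poisson B z $ i)"
  by (cases i) (simp_all add: bracket_field_poisson assms lipschitz_near_minus lipschitz_near_smooth smooth_partial)

text \<open>Bridge from analysis to brackets: tangency of a Hamiltonian field to a level set becomes
  the vanishing of a Poisson bracket.\<close>

lemma frechet_derivative_bracket_field:
  assumes "A differentiable (at z)"
  shows "frechet_derivative A (at z) (bracket_field poisson B z) = poisson A B z"
proof -
  \<comment> \<open>Writing the index set as a disjoint sum lets \<open>sum.Plus\<close> separate
    positions from momenta.\<close>
  have "frechet_derivative A (at z) (bracket_field poisson B z)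
      = (\<Sum>i\<in>UNIV <+> UNIV. partial i A z * bracket_field poisson B z $ i)"
    by (simp add: frechet_derivative_eq_sum_partial[OF assms])
  also have "\<dots> = poisson A B z"
    by (subst sum.Plus)
      (simp_all add: poisson_def bracket_field_poisson sum_subtractf sum_negf mult.commute)
  finally show ?thesis .
qed

section \<open>Existence of integral curves\<close>

text \<open>Banach's fixed point theorem for the integral operator. The complete space is the type
  of bounded continuous functions on the whole real line, so the operator has to yield bounded
  functions defined at all times.\<close>

lemma picard_lindeloef_global:
  fixes F :: "'a::banach \<Rightarrow> 'a"
  assumes L: "L-lipschitz_on UNIV F"
  obtains e x where "e > 0" "x t0 = x0"
    "\<And>t. t \<in> {t0 - e<..<t0 + e} \<Longrightarrow> (x has_vector_derivative F (x t)) (at t)"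
proof -
  have L0: "L \<ge> 0"
    using L by (rule lipschitz_on_nonneg)
  have contF: "continuous_on S F" for S
    using lipschitz_on_continuous_on[OF L] continuous_on_subset by blast
  \<comment> \<open>The contraction factor will be \<open>3 * e * L\<close>: the integral up to
    \<open>c t\<close> covers a length of at most \<open>2 * e\<close>, the one up to
    \<open>t0\<close> a length of \<open>e\<close>. Using \<open>L + 1\<close> avoids division by
    zero when \<open>L = 0\<close>.\<close>
  define e where "e = 1 / (4 * (L + 1))"
  have e0: "e > 0" and eL: "3 * e * L < 1"
    using L0 by (simp_all add: e_def field_simps)
  define a b where "a = t0 - e" and "b = t0 + e"
  \<comment> \<open>Clamping time to the interval makes the operator's values constant outside it,
    hence bounded.\<close>
  define c where "c t = max a (min b t)" for t
  have c: "c t \<in> {a..b}" for t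
    using e0 by (auto simp: c_def a_def b_def)
  have cid: "c t = t" if "t \<in> {a..b}" for t
    using that by (auto simp: c_def)
  have t0: "t0 \<in> {a..b}"
    using e0 by (auto simp: a_def b_def)
  \<comment> \<open>The difference of two integrals from \<open>a\<close> stands for the oriented
    integral from \<open>t0\<close> to \<open>c t\<close>, which may run backwards.\<close>
  define G where "G u t = x0 + integral {a..c t} (\<lambda>s. F (u s)) - integral {a..t0} (\<lambda>s. F (u s))" for u t
  have contFu: "continuous_on S (\<lambda>s. F (apply_bcontfun u s))" for u S
    by (rule continuous_on_compose2[OF contF[of UNIV]]) auto
  have G_bcontfun: "G (apply_bcontfun u) \<in> bcontfun" for u
  proof -
    have I: "continuous_on {a..b} (\<lambda>t. integral {a..t} (\<lambda>s. F (apply_bcontfun u s)))"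
      by (intro indefinite_integral_continuous_1 integrable_continuous_real contFu)
    have "continuous_on UNIV (\<lambda>t. integral {a..c t} (\<lambda>s. F (apply_bcontfun u s)))"
    proof (rule continuous_on_compose2[OF I])
      show "continuous_on UNIV c"
        unfolding c_def[abs_def] by (intro continuous_intros)
    qed (use c in auto)
    then have "continuous_on UNIV (G (apply_bcontfun u))"
      unfolding G_def[abs_def] by (intro continuous_intros)
    moreover have "bounded (range (G (apply_bcontfun u)))"
    proof -
      have "range (G (apply_bcontfun u)) \<subseteq> (\<lambda>t. x0 + integral {a..t} (\<lambda>s. F (apply_bcontfun u s))
          - integral {a..t0} (\<lambda>s. F (apply_bcontfun u s))) ` {a..b}"
        using c by (auto simp: G_def)
      moreover have "compact \<dots>"
        by (intro compact_continuous_image continuous_intros I) auto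
      ultimately show ?thesis
        using bounded_subset compact_imp_bounded by blast
    qed
    ultimately show ?thesis
      by (simp add: bcontfun_def)
  qed
  define T where "T u = Bcontfun (G (apply_bcontfun u))" for u
  have T: "apply_bcontfun (T u) = G (apply_bcontfun u)" for u
    unfolding T_def by (rule Bcontfun_inverse[OF G_bcontfun])
  have "dist (T u) (T v) \<le> (3 * e * L) * dist u v" for u v
  proof (rule dist_bound)
    fix t
    let ?D = "\<lambda>s. F (apply_bcontfun u s) - F (apply_bcontfun v s)"
    have I: "norm (integral {a..r} ?D) \<le> (L * dist u v) * (r - a)" if "r \<in> {a..b}" for r
    proof (rule integral_bound)
      show "norm (?D s) \<le> L * dist u v" for s
        using lipschitz_onD[OF L, of "apply_bcontfun u s" "apply_bcontfun v s"] dist_bounded[of u s v] L0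
        by (simp add: dist_norm[symmetric]) (meson mult_left_mono order_trans)
    qed (use that in \<open>auto intro: continuous_intros contFu\<close>)
    have "apply_bcontfun (T u) t - apply_bcontfun (T v) t = integral {a..c t} ?D - integral {a..t0} ?D"
      by (simp add: T G_def integral_diff integrable_continuous_real contFu)
    then have "dist (apply_bcontfun (T u) t) (apply_bcontfun (T v) t)
        \<le> norm (integral {a..c t} ?D) + norm (integral {a..t0} ?D)"
      by (simp add: dist_norm norm_triangle_ineq4)
    also have "\<dots> \<le> (L * dist u v) * (c t - a) + (L * dist u v) * (t0 - a)"
      by (intro add_mono I c t0)
    also have "\<dots> \<le> (L * dist u v) * (2 * e) + (L * dist u v) * e"
      using c[of t] L0 by (intro add_mono mult_left_mono) (auto simp: a_def b_def)
    finally show "dist (apply_bcontfun (T u) t) (apply_bcontfun (T v) t) \<le> (3 * e * L) * dist u v"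
      by (simp add: algebra_simps)
  qed
  then obtain w where w: "T w = w"
    using banach_fix_type[of "3 * e * L" T] eL e0 L0 by auto
  define x where "x = apply_bcontfun w"
  have x: "x t = x0 + integral {a..t} (\<lambda>s. F (x s)) - integral {a..t0} (\<lambda>s. F (x s))"
    if "t \<in> {a..b}" for t
  proof -
    have "x t = G x t"
      using fun_cong[OF T[of w], of t] by (simp only: w x_def)
    then show ?thesis
      by (simp only: G_def cid[OF that])
  qed
  show thesis
  proof (rule that[OF e0])
    show "x t0 = x0"
      using x[OF t0] by simp
    fix t
    assume "t \<in> {t0 - e<..<t0 + e}"
    then have t: "t \<in> {a<..<b}"
      by (simp add: a_def b_def)
    have "((\<lambda>r. integral {a..r} (\<lambda>s. F (x s))) has_vector_derivative F (x t)) (at t within {a..b})"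
      using t by (intro integral_has_vector_derivative) (auto simp: x_def contFu)
    then have "((\<lambda>r. integral {a..r} (\<lambda>s. F (x s))) has_vector_derivative F (x t)) (at t)"
      using t by (simp add: at_within_Icc_at)
    then have "((\<lambda>r. x0 + integral {a..r} (\<lambda>s. F (x s)) - integral {a..t0} (\<lambda>s. F (x s)))
        has_vector_derivative F (x t)) (at t)"
      by (auto intro!: derivative_eq_intros)
    then show "(x has_vector_derivative F (x t)) (at t)"
      by (rule has_vector_derivative_transform_within_open[of _ _ _ "{a<..<b}"])
        (use t in \<open>auto intro!: x[symmetric]\<close>)
  qed
qed

text \<open>A curve of the modified, globally Lipschitz field starts at the centre of the ball. By
  continuity it stays for a short time in the open ball, where the modification changes nothing, and
  also in \<open>U\<close>.\<close>

lemma picard_lindeloef_local: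
  fixes V :: "'a::euclidean_space \<Rightarrow> 'a"
  assumes "lipschitz_near x0 V" and U: "open U" "x0 \<in> U"
  obtains e x where "e > 0" "x t0 = x0"
    "\<And>t. t \<in> {t0 - e<..<t0 + e} \<Longrightarrow> x t \<in> U \<and> (x has_vector_derivative V (x t)) (at t)"
proof -
  obtain r L where r: "r > 0" and L: "L-lipschitz_on (cball x0 r) V"
    using assms(1) unfolding lipschitz_near_def by blast
  let ?P = "closest_point (cball x0 r)"
  have P: "?P y \<in> cball x0 r" for y
    using r by (intro closest_point_in_set) auto
  \<comment> \<open>Projecting onto the ball makes the field globally Lipschitz.\<close>
  have "L-lipschitz_on UNIV (\<lambda>y. V (?P y))"
  proof (rule lipschitz_onI)
    fix y z
    have "dist (V (?P y)) (V (?P z)) \<le> L * dist (?P y) (?P z)"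
      by (rule lipschitz_onD[OF L P P])
    also have "\<dots> \<le> L * dist y z"
      using r lipschitz_on_nonneg[OF L] by (intro mult_left_mono closest_point_lipschitz) auto
    finally show "dist (V (?P y)) (V (?P z)) \<le> L * dist y z" .
  qed (rule lipschitz_on_nonneg[OF L])
  then obtain e x where e: "e > 0" and x0: "x t0 = x0"
    and x: "\<And>t. t \<in> {t0 - e<..<t0 + e} \<Longrightarrow> (x has_vector_derivative V (?P (x t))) (at t)"
    by (rule picard_lindeloef_global[of _ _ t0 x0]) blast
  have "isCont x t0"
    using x[of t0] e by (auto intro: has_vector_derivative_continuous)
  moreover have "open (ball x0 r \<inter> U)" "x t0 \<in> ball x0 r \<inter> U"
    using U r x0 by auto
  ultimately have "eventually (\<lambda>t. x t \<in> ball x0 r \<inter> U) (nhds t0)"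
    by (metis continuous_at eventually_nhds_x_imp_x tendsto_def tendsto_at_iff_tendsto_nhds)
  then obtain d where d: "d > 0" "\<And>t. dist t t0 < d \<Longrightarrow> x t \<in> ball x0 r \<inter> U"
    unfolding eventually_nhds_metric by blast
  show thesis
  proof (rule that[of "min e d"])
    fix t
    assume t: "t \<in> {t0 - min e d<..<t0 + min e d}"
    then have "x t \<in> ball x0 r \<inter> U"
      by (intro d(2)) (auto simp: dist_real_def)
    moreover from this have "?P (x t) = x t"
      by (intro closest_point_self) auto
    ultimately show "x t \<in> U \<and> (x has_vector_derivative V (x t)) (at t)"
      using x[of t] t by (simp add: min_def split: if_splits)
  qed (use e d x0 in auto)
qed

section \<open>First integrals\<close>

text \<open>By the chain rule \<open>f\<close> has zero derivative along the curve. Tangency is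
  required only at points of the curve, because the Dirac field is shown to be tangent only where
  the bracket matrix is invertible.\<close>

lemma first_integrals_constant_along_flow:
  fixes V :: "real ^ 'i \<Rightarrow> real ^ 'i"
  assumes V: "\<And>t. t \<in> {t0 - e<..<t0 + e} \<Longrightarrow> (x has_vector_derivative V (x t)) (at t)"
    and diff: "\<And>z. f differentiable (at z)"
    and zero: "\<And>t. t \<in> {t0 - e<..<t0 + e} \<Longrightarrow> frechet_derivative f (at (x t)) (V (x t)) = 0"
    and t: "t \<in> {t0 - e<..<t0 + e}"
  shows "f (x t) = f (x t0)"
proof -
  have "((\<lambda>t. f (x t)) has_derivative (\<lambda>h. 0)) (at s within {t0 - e<..<t0 + e})"
    if s: "s \<in> {t0 - e<..<t0 + e}" for s
  proof -
    have "(f has_derivative frechet_derivative f (at (x s))) (at (x s))"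
      using diff frechet_derivative_works by blast
    from vector_derivative_diff_chain_within[OF V[OF s] has_derivative_at_withinI[OF this]]
    have "((\<lambda>t. f (x t)) has_vector_derivative 0) (at s)"
      by (simp add: zero[OF s] o_def)
    then show ?thesis
      by (simp add: has_vector_derivative_def has_derivative_at_withinI)
  qed
  then obtain k where "\<And>s. s \<in> {t0 - e<..<t0 + e} \<Longrightarrow> f (x s) = k"
    using has_derivative_zero_constant[OF convex_real_interval(8), where f = "\<lambda>t. f (x t)"] by blast
  \<comment> \<open>A point \<open>t\<close> in the interval forces \<open>e > 0\<close>, so
    \<open>t0\<close> lies in it too.\<close>
  with t show ?thesis
    by auto
qed

section \<open>The Dirac field and its tangency to the constraints\<close>

text \<open>Cramer's rule for \<open>\<triangle>\<^sup>-\<^sup>1 {\<Phi>, H}\<close>: a quotient of polynomials in Poisson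
  brackets, hence visibly Lipschitz wherever \<open>det \<triangle> \<noteq> 0\<close>.\<close>

definition multiplier ::
  "('k::finite \<Rightarrow> real ^ ('n + 'n) \<Rightarrow> real) \<Rightarrow> (real ^ ('n + 'n) \<Rightarrow> real) \<Rightarrow>
   real ^ ('n::finite + 'n) \<Rightarrow> real ^ 'k" where
  "multiplier \<Phi> H z = (\<chi> k. det (\<chi> i j. if j = k then poisson (\<Phi> i) H z else bracket_matrix \<Phi> z $ i $ j)
     / det (bracket_matrix \<Phi> z))"

text \<open>Both directions serve: right to left, the multiplier solves the linear system, which
  gives tangency; left to right, it is the only solution, so it vanishes when the right-hand side
  does.\<close>

lemma bracket_matrix_mult_eq_iff:
  assumes "det (bracket_matrix \<Phi> z) \<noteq> 0"
  shows "bracket_matrix \<Phi> z *v x = (\<chi> \<alpha>. poisson (\<Phi> \<alpha>) H z) \<longleftrightarrow> x = multiplier \<Phi> H z"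
  by (simp add: cramer[OF assms] multiplier_def cong: if_cong)

lemma sum_poisson_mult_multiplier:
  assumes "det (bracket_matrix \<Phi> z) \<noteq> 0"
  shows "(\<Sum>\<beta>\<in>UNIV. poisson (\<Phi> \<alpha>) (\<Phi> \<beta>) z * multiplier \<Phi> H z $ \<beta>) = poisson (\<Phi> \<alpha>) H z"
  using bracket_matrix_mult_eq_iff[OF assms, of "multiplier \<Phi> H z" H]
  by (simp add: vec_eq_iff matrix_vector_mult_def bracket_matrix_def)

lemma multiplier_eq_0:
  assumes "det (bracket_matrix \<Phi> z) \<noteq> 0" "\<And>\<alpha>. poisson (\<Phi> \<alpha>) H z = 0"
  shows "multiplier \<Phi> H z = 0"
  using bracket_matrix_mult_eq_iff[OF assms(1), of 0 H] assms(2) by (simp add: vec_eq_iff)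

text \<open>The Hamiltonian field of \<open>H\<close> for the Dirac bracket, wherever \<open>\<triangle>\<close> is invertible.\<close>

definition dirac_flow_field ::
  "('k::finite \<Rightarrow> real ^ ('n + 'n) \<Rightarrow> real) \<Rightarrow> (real ^ ('n + 'n) \<Rightarrow> real) \<Rightarrow>
   real ^ ('n::finite + 'n) \<Rightarrow> real ^ ('n + 'n)" where
  "dirac_flow_field \<Phi> H z = bracket_field poisson H z -
     (\<Sum>\<beta>\<in>UNIV. multiplier \<Phi> H z $ \<beta> *\<^sub>R bracket_field poisson (\<Phi> \<beta>) z)"

text \<open>Invertibility at \<open>z\<close> alone suffices, since
  \<open>lipschitz_near_inverse\<close> finds its own ball around \<open>z\<close>.\<close>

lemma lipschitz_near_dirac_flow_field:
  assumes "smooth H" "\<And>\<alpha>. smooth (\<Phi> \<alpha>)" "det (bracket_matrix \<Phi> z) \<noteq> 0"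
  shows "lipschitz_near z (dirac_flow_field \<Phi> H)"
proof -
  have B: "lipschitz_near z (\<lambda>y. bracket_matrix \<Phi> y $ i $ j)" for i j
    by (simp add: bracket_matrix_def lipschitz_near_poisson assms)
  \<comment> \<open>These are the entries of Cramer's numerator matrix, whose column
    \<open>k\<close> is replaced by the brackets with \<open>H\<close>.\<close>
  have N: "lipschitz_near z (\<lambda>y. (\<chi> i j. if j = k then poisson (\<Phi> i) H y else bracket_matrix \<Phi> y $ i $ j) $ i $ j)"
    for i j k
    by (cases "j = k") (simp_all add: B lipschitz_near_poisson assms)
  have "lipschitz_near z (\<lambda>y. multiplier \<Phi> H y $ k)" for k
    unfolding multiplier_def vec_lambda_beta divide_inverse
    by (intro lipschitz_near_mult lipschitz_near_inverse lipschitz_near_det B N assms)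
  then show ?thesis
    by (intro lipschitz_near_vec)
      (simp add: dirac_flow_field_def,
       intro lipschitz_near_diff lipschitz_near_sum lipschitz_near_mult
         lipschitz_near_bracket_field_poisson assms)
qed

text \<open>Differentiating along the field gives the bracket of the constraint with
  \<open>H\<close> minus its brackets with all constraints, weighted by the multiplier. The linear
  system defining the multiplier makes these cancel, off the surface as well.\<close>

lemma dirac_flow_field_tangent:
  assumes "\<Phi> \<alpha> differentiable (at z)" "det (bracket_matrix \<Phi> z) \<noteq> 0"
  shows "frechet_derivative (\<Phi> \<alpha>) (at z) (dirac_flow_field \<Phi> H z) = 0"
proof -
  interpret linear "frechet_derivative (\<Phi> \<alpha>) (at z)"
    by (rule linear_frechet_derivative[OF assms(1)])
  show ?thesis
    using sum_poisson_mult_multiplier[OF assms(2), of \<alpha> H]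
    by (simp add: dirac_flow_field_def diff sum scale frechet_derivative_bracket_field[OF assms(1)] mult.commute)
qed

section \<open>Self-consistency and equality of the solution sets\<close>

theorem mainTheorem8:
  fixes H :: "real ^ ('n::finite + 'n) \<Rightarrow> real"
    and \<Phi> :: "'k::finite \<Rightarrow> real ^ ('n + 'n) \<Rightarrow> real"
    and p :: nat
  assumes "CARD('k) = 2 * p" and "2 * p < 2 * CARD('n)"
    and "smooth H" and "\<And>\<alpha>. smooth (\<Phi> \<alpha>)"
    and "functionally_independent_on (constraint_surface \<Phi>) \<Phi>"
    and "\<And>z. z \<in> constraint_surface \<Phi> \<Longrightarrow> det (bracket_matrix \<Phi> z) \<noteq> 0"
    and "\<And>\<alpha> z. z \<in> constraint_surface \<Phi> \<Longrightarrow> poisson (\<Phi> \<alpha>) H z = 0"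
  shows "self_consistent (bracket_field poisson H) \<Phi> \<and>
    same_solutions (bracket_field poisson H) \<Phi> (bracket_field (dirac \<Phi>) H) \<Phi>"
proof
  have diff: "\<Phi> \<alpha> differentiable (at z)" for \<alpha> z
    by (intro smooth_differentiable assms)
  \<comment> \<open>The curve must be kept in this open set first: tangency along it is needed
    before it is known to lie on the surface.\<close>
  define U where "U = {z. det (bracket_matrix \<Phi> z) \<noteq> 0}"
  have "isCont (\<lambda>z. det (bracket_matrix \<Phi> z)) z" for z
    by (intro lipschitz_near_isCont lipschitz_near_det)
      (simp add: bracket_matrix_def lipschitz_near_poisson assms)
  then have U: "open U"
    unfolding U_def by (intro open_Collect_neq continuous_on_const continuous_at_imp_continuous_on) auto
  show "self_consistent (bracket_field poisson H) \<Phi>"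
    unfolding self_consistent_def
  proof (intro ballI allI)
    fix z\<^sub>0 \<tau>\<^sub>0
    assume z0: "z\<^sub>0 \<in> constraint_surface \<Phi>"
    obtain \<epsilon> z where \<epsilon>: "\<epsilon> > 0" and z_init: "z \<tau>\<^sub>0 = z\<^sub>0"
      and z: "\<And>t. t \<in> {\<tau>\<^sub>0 - \<epsilon><..<\<tau>\<^sub>0 + \<epsilon>} \<Longrightarrow>
        z t \<in> U \<and> (z has_vector_derivative dirac_flow_field \<Phi> H (z t)) (at t)"
      using picard_lindeloef_local[OF lipschitz_near_dirac_flow_field[OF assms(3,4) assms(6)[OF z0]] U]
        assms(6)[OF z0] unfolding U_def by blast
    have on: "z t \<in> constraint_surface \<Phi>" if "t \<in> {\<tau>\<^sub>0 - \<epsilon><..<\<tau>\<^sub>0 + \<epsilon>}" for t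
    proof -
      have "\<Phi> \<alpha> (z t) = \<Phi> \<alpha> (z \<tau>\<^sub>0)" for \<alpha>
        using z that
        by (intro first_integrals_constant_along_flow[where V = "dirac_flow_field \<Phi> H" and e = \<epsilon>])
          (auto simp: U_def diff dirac_flow_field_tangent)
      then show ?thesis
        using z0 by (simp add: constraint_surface_def z_init)
    qed
    \<comment> \<open>On the surface the brackets with \<open>H\<close> vanish, hence so does the
      multiplier, and the correction term disappears.\<close>
    have "dirac_flow_field \<Phi> H (z t) = bracket_field poisson H (z t)"
      if "t \<in> {\<tau>\<^sub>0 - \<epsilon><..<\<tau>\<^sub>0 + \<epsilon>}" for t
      using multiplier_eq_0[of \<Phi> "z t" H] assms(6,7)[OF on[OF that]] by (simp add: dirac_flow_field_def)
    then have "solution_on (bracket_field poisson H) \<Phi> {\<tau>\<^sub>0 - \<epsilon><..<\<tau>\<^sub>0 + \<epsilon>} z"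
      using z on by (force simp: solution_on_def constraint_surface_def)
    then show "\<exists>\<epsilon>>0. \<exists>z. z \<tau>\<^sub>0 = z\<^sub>0 \<and>
        solution_on (bracket_field poisson H) \<Phi> {\<tau>\<^sub>0 - \<epsilon><..<\<tau>\<^sub>0 + \<epsilon>} z"
      using \<epsilon> z_init by blast
  qed
  \<comment> \<open>Each term of the Dirac correction contains a bracket of a constraint with
    \<open>H\<close>, which is zero on the surface. Solutions of either system lie there, so
    agreement of the fields on the surface is enough.\<close>
  have eq: "bracket_field (dirac \<Phi>) H z = bracket_field poisson H z" if "\<forall>\<alpha>. \<Phi> \<alpha> z = 0" for z
    using assms(7)[of z] that by (simp add: bracket_field_def dirac_def constraint_surface_def)
  have "solution_on (bracket_field poisson H) \<Phi> T z = solution_on (bracket_field (dirac \<Phi>) H) \<Phi> T z"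
    for T z
    unfolding solution_on_def by (intro ball_cong refl) (auto simp: eq)
  then show "same_solutions (bracket_field poisson H) \<Phi> (bracket_field (dirac \<Phi>) H) \<Phi>"
    unfolding same_solutions_def by blast
qed

end
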